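(* Let $A,B,C\in\mathbb{R}^{n\times n}$, let $Y\in\mathbb{R}^{n\times n}$ be an approximate solution of the matrix equation $X=AX^\top B+C$, put $\alpha=\|A\|_F$, $\beta=\|B\|_F$, $\gamma=\|C\|_F$, and define the normwise backward error of $Y$ by $$\eta(Y)=\min\{\epsilon:\ Y=(C+\delta C)+(A+\delta A)Y^\top(B+\delta B),\ \|\delta A\|_F\le\epsilon\alpha,\ \|\delta B\|_F\le\epsilon\beta,\ \|\delta C\|_F\le\epsilon\gamma\}.$$ Then the residual $\mathcal{R}=Y-AY^\top B-C$ satisfies $$\|\mathcal{R}\|_F\le\eta(Y)\bigl(\gamma+\|Y\|_F\,\alpha\beta\,(2+\eta(Y))\bigr).$$
   Context: $\|\cdot\|_F$ is the Frobenius norm and $X^\top$ is the transpose of $X$. The matrices $\delta A,\delta B,\delta C$ are perturbations of $A,B,C$. For perturbations as in the definition of $\eta(Y)$, the residual can be written as $\mathcal{R}=\delta C+\delta A\,Y^\top B+AY^\top\delta B+\delta A\,Y^\top\delta B$. *)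

theory Defs
  imports "HOL-Analysis.Analysis"
begin

definition frobenius_norm :: "real ^ 'n ^ 'm \<Rightarrow> real" where
  "frobenius_norm A = sqrt (\<Sum>i\<in>UNIV. \<Sum>j\<in>UNIV. (A $ i $ j)\<^sup>2)"

lemma frobenius_norm_eq_norm: "frobenius_norm A = norm A"
  by (simp add: frobenius_norm_def norm_vec_def L2_set_def sum_nonneg)

definition residual ::
  "real ^ 'n ^ 'n \<Rightarrow> real ^ 'n ^ 'n \<Rightarrow> real ^ 'n ^ 'n \<Rightarrow> real ^ 'n ^ 'n \<Rightarrow> real ^ 'n ^ 'n" where
  "residual A B C Y = Y - A ** transpose Y ** B - C"

(* The condition 0 \<le> \<epsilon> follows from the norm bounds unless A = B = C = 0;
   in that case it excludes negative \<epsilon>, for which the bounds would be vacuous. *)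
definition backward_error_set ::
  "real ^ 'n ^ 'n \<Rightarrow> real ^ 'n ^ 'n \<Rightarrow> real ^ 'n ^ 'n \<Rightarrow> real ^ 'n ^ 'n \<Rightarrow> real set" where
  "backward_error_set A B C Y =
    {\<epsilon>. 0 \<le> \<epsilon> \<and>
      (\<exists>\<delta>A \<delta>B \<delta>C :: real ^ 'n ^ 'n.
        Y = (C + \<delta>C) + (A + \<delta>A) ** transpose Y ** (B + \<delta>B) \<and>
        frobenius_norm \<delta>A \<le> \<epsilon> * frobenius_norm A \<and>
        frobenius_norm \<delta>B \<le> \<epsilon> * frobenius_norm B \<and>
        frobenius_norm \<delta>C \<le> \<epsilon> * frobenius_norm C)}"

(* The minimum of the set, a meaningful value only if the set is nonempty. It can be
   empty, e.g. for A = B = C = 0 and Y \<noteq> 0. *)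
definition backward_error ::
  "real ^ 'n ^ 'n \<Rightarrow> real ^ 'n ^ 'n \<Rightarrow> real ^ 'n ^ 'n \<Rightarrow> real ^ 'n ^ 'n \<Rightarrow> real" where
  "backward_error A B C Y = (LEAST \<epsilon>. \<epsilon> \<in> backward_error_set A B C Y)"

end

theory Submission imports Defs begin

text \<open>
  The residual bound holds for every admissible \<open>\<epsilon>\<close>: expanding the perturbed equation writes the
  residual as \<open>\<delta>C + \<delta>A Y\<^sup>T B + A Y\<^sup>T \<delta>B + \<delta>A Y\<^sup>T \<delta>B\<close>, and submultiplicativity of the Frobenius
  norm bounds the summands by \<open>\<epsilon>\<gamma>\<close>, twice \<open>\<epsilon>\<alpha>\<beta>\<parallel>Y\<parallel>\<close> and \<open>\<epsilon>\<^sup>2\<alpha>\<beta>\<parallel>Y\<parallel>\<close>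
  (lemma \<open>residual_bound\<close>).

  It remains to see that the backward error is itself admissible, that is, that the minimum defining
  it is attained (lemma \<open>backward_error_in_set\<close>). The reason is compactness: once some \<open>b\<close> is
  admissible, only \<open>\<epsilon> \<le> b\<close> matters, and the tuples \<open>(\<epsilon>, \<delta>A, \<delta>B, \<delta>C)\<close> with \<open>\<epsilon> \<le> b\<close> that satisfy
  the constraints form a closed and bounded set in a finite-dimensional space.
\<close>

lemma norm_matrix_squared:
  fixes A :: "real ^ 'n ^ 'm"
  shows "(norm A)\<^sup>2 = (\<Sum>i\<in>UNIV. \<Sum>j\<in>UNIV. (A $ i $ j)\<^sup>2)"
  by (simp add: norm_vec_def L2_set_def sum_nonneg)

lemma norm_transpose:
  fixes A :: "real ^ 'n ^ 'm"
  shows "norm (transpose A) = norm A"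
proof -
  have "(norm (transpose A))\<^sup>2 = (norm A)\<^sup>2"
    unfolding norm_matrix_squared by (simp add: transpose_def) (rule sum.swap)
  then show ?thesis
    by simp
qed

text \<open>Each entry of the product is an inner product of a row and a column, so Cauchy-Schwarz bounds its
  square by a product of squared norms; summing over all rows and columns separates the factors.\<close>
lemma norm_matrix_mult_le:
  fixes A :: "real ^ 'n ^ 'm" and B :: "real ^ 'p ^ 'n"
  shows "norm (A ** B) \<le> norm A * norm B"
proof (rule power2_le_imp_le)
  have "(norm (A ** B))\<^sup>2 =
      (\<Sum>i\<in>UNIV. \<Sum>j\<in>UNIV. (\<Sum>k\<in>UNIV. A $ i $ k * B $ k $ j)\<^sup>2)"
    by (simp add: norm_matrix_squared matrix_matrix_mult_def)
  also have "\<dots> \<le> (\<Sum>i\<in>UNIV. \<Sum>j\<in>UNIV.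
      (\<Sum>k\<in>UNIV. (A $ i $ k)\<^sup>2) * (\<Sum>k\<in>UNIV. (B $ k $ j)\<^sup>2))"
    by (intro sum_mono Cauchy_Schwarz_ineq_sum)
  also have "\<dots> = (norm A)\<^sup>2 * (norm (transpose B))\<^sup>2"
    by (simp add: norm_matrix_squared sum_product transpose_def)
  also have "\<dots> = (norm A * norm B)\<^sup>2"
    by (simp add: norm_transpose power_mult_distrib)
  finally show "(norm (A ** B))\<^sup>2 \<le> (norm A * norm B)\<^sup>2" .
qed simp

text \<open>Bilinearity gives the expansion of products of perturbed matrices, boundedness their continuity.\<close>
lemma bounded_bilinear_matrix_mult:
  "bounded_bilinear ((**) :: real ^ 'n ^ 'm \<Rightarrow> real ^ 'p ^ 'n \<Rightarrow> real ^ 'p ^ 'm)"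
proof
  show "\<exists>K. \<forall>A B. norm ((A :: real ^ 'n ^ 'm) ** (B :: real ^ 'p ^ 'n)) \<le> norm A * norm B * K"
    by (rule exI[of _ 1]) (simp add: norm_matrix_mult_le)
qed (simp_all add: matrix_matrix_mult_def vec_eq_iff
      sum.distrib sum_distrib_left algebra_simps)

lemmas continuous_on_matrix_mult [continuous_intros] =
  bounded_bilinear.continuous_on[OF bounded_bilinear_matrix_mult]

text \<open>The admissible \<open>\<epsilon>\<close> are the first coordinates of the feasible tuples. Any admissible \<open>b\<close> bounds
  the minimum from above and truncates the feasible set to a compact one.\<close>
lemma backward_error_in_set:
  fixes A B C Y :: "real ^ 'n ^ 'n"
  assumes "backward_error_set A B C Y \<noteq> {}"
  shows "backward_error A B C Y \<in> backward_error_set A B C Y"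
proof -
  let ?S = "backward_error_set A B C Y"
  define F where "F = {(e, D, E, G).
      Y = (C + G) + (A + D) ** transpose Y ** (B + E) \<and>
      norm D \<le> e * norm A \<and> norm E \<le> e * norm B \<and> norm G \<le> e * norm C}"
  have S_iff: "e \<in> ?S \<longleftrightarrow> 0 \<le> e \<and> (\<exists>D E G. (e, D, E, G) \<in> F)" for e
    by (simp add: backward_error_set_def F_def frobenius_norm_eq_norm)
  obtain b where b: "b \<in> ?S"
    using assms by blast
  define T where "T = ({0..b} \<times> cball 0 (b * norm A) \<times> cball 0 (b * norm B) \<times> cball 0 (b * norm C)) \<inter> F"
  have "closed F"
    unfolding F_def case_prod_unfold
    by (intro closed_Collect_conj closed_Collect_eq closed_Collect_le continuous_intros)
  then have "compact T"
    unfolding T_def by (intro compact_Int_closed compact_Times compact_Icc compact_cball)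
  have in_T: "(e, D, E, G) \<in> T" if "0 \<le> e" "e \<le> b" "(e, D, E, G) \<in> F" for e D E G
  proof -
    have "e * norm X \<le> b * norm X" for X :: "real ^ 'n ^ 'n"
      using that by (simp add: mult_right_mono)
    then show ?thesis
      using that unfolding T_def F_def by (auto intro: order_trans)
  qed
  have "T \<noteq> {}"
    using b in_T S_iff by blast
  then obtain t where t: "t \<in> T" "\<And>s. s \<in> T \<Longrightarrow> fst t \<le> fst s"
    using continuous_attains_inf[OF \<open>compact T\<close>, of fst] continuous_on_fst[OF continuous_on_id] by blast
  have "fst t \<in> ?S" 
    using t(1) unfolding S_iff T_def by (cases t) auto
  moreover have "fst t \<le> e" if "e \<in> ?S" for e
  proof (cases "e \<le> b")
    case True
    then show ?thesis using that t(2) in_T unfolding S_iff by fastforce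
  next
    case False
    then show ?thesis using t(1) by (auto simp: T_def)
  qed
  ultimately show ?thesis
    unfolding backward_error_def by (rule LeastI2_order) simp
qed

lemma residual_bound:
  fixes A B C Y :: "real ^ 'n ^ 'n"
  assumes "e \<in> backward_error_set A B C Y"
  shows "norm (residual A B C Y) \<le> e * (norm C + norm Y * norm A * norm B * (2 + e))"
proof -
  obtain D E G where Y: "Y = (C + G) + (A + D) ** transpose Y ** (B + E)"
    and D: "norm D \<le> e * norm A" and E: "norm E \<le> e * norm B" and G: "norm G \<le> e * norm C"
    and e: "0 \<le> e"
    using assms by (auto simp: backward_error_set_def frobenius_norm_eq_norm)
  let ?Z = "transpose Y"
  have triple: "norm (P ** ?Z ** Q) \<le> p * norm Y * q"
    if "norm P \<le> p" "norm Q \<le> q" for P Q :: "real ^ 'n ^ 'n" and p q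
  proof -
    have "norm (P ** ?Z ** Q) \<le> norm P * norm Y * norm Q"
      using norm_matrix_mult_le[of "P ** ?Z" Q] norm_matrix_mult_le[of P ?Z]
      by (metis norm_transpose mult_right_mono norm_ge_zero order_trans)
    also have "\<dots> \<le> p * norm Y * q"
      using that by (intro mult_mono) (auto intro: order_trans[OF norm_ge_zero] mult_nonneg_nonneg)
    finally show ?thesis .
  qed
  have "(A + D) ** ?Z ** (B + E) =
      A ** ?Z ** B + (D ** ?Z ** B + A ** ?Z ** E + D ** ?Z ** E)"
    by (simp add: bounded_bilinear.add_left[OF bounded_bilinear_matrix_mult]
        bounded_bilinear.add_right[OF bounded_bilinear_matrix_mult])
  then have "residual A B C Y = G + (D ** ?Z ** B + A ** ?Z ** E + D ** ?Z ** E)"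
    using Y unfolding residual_def by (simp add: algebra_simps)
  also have "norm \<dots> \<le> norm G + (norm (D ** ?Z ** B) + norm (A ** ?Z ** E) + norm (D ** ?Z ** E))"
    by (intro norm_triangle_mono order_refl)
  also have "\<dots> \<le> e * norm C + ((e * norm A) * norm Y * norm B + norm A * norm Y * (e * norm B)
      + (e * norm A) * norm Y * (e * norm B))"
    using D E G by (intro add_mono triple order_refl)
  also have "\<dots> = e * (norm C + norm Y * norm A * norm B * (2 + e))"
    by (simp add: algebra_simps)
  finally show ?thesis .
qed

theorem mainTheorem3:
  fixes A B C Y :: "real ^ 'n ^ 'n" and \<alpha> \<beta> \<gamma> :: real
  assumes "\<alpha> = frobenius_norm A" and "\<beta> = frobenius_norm B" and "\<gamma> = frobenius_norm C"
    and "backward_error_set A B C Y \<noteq> {}"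
  shows "frobenius_norm (residual A B C Y)
    \<le> backward_error A B C Y *
      (\<gamma> + frobenius_norm Y * \<alpha> * \<beta> * (2 + backward_error A B C Y))"
  using residual_bound[OF backward_error_in_set[OF assms(4)]]
  by (simp add: assms(1-3) frobenius_norm_eq_norm)

end
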